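(* Let $X$ and $Y$ be Banach spaces, let $A\subseteq X$ be an open subset, $W\subseteq X$ a subspace, and $K\subseteq W\cap A$ a compact and convex subset. Let $F\in C^1(A,Y)$ be a Lipschitz map satisfying the Lipschitz stability estimate $$\|x_1-x_2\|_X\le C\,\|F(x_1)-F(x_2)\|_Y,\qquad x_1,x_2\in K,$$ for some $C\ge 1$. Let $Q_N\colon Y\to Y$, $N\in\mathbb{N}$, be bounded linear maps, and assume that there exist a subspace $\tilde Y$ of $Y$ and a constant $D\ge 1$ such that: (a) $\operatorname{ran}\bigl(F'(\xi)|_W\bigr)\subseteq\tilde Y$ for every $\xi\in K$; (b) $\|Q_N\|_{Y\to Y}\le D$ for every $N\in\mathbb{N}$; (c) $Q_N|_{\tilde Y}\to I_{\tilde Y}$ in the strong operator topology as $N\to+\infty$, i.e. $\|Q_Ny-y\|_Y\to 0$ for every $y\in\tilde Y$. For $N\in\mathbb{N}$ set $$s_N=\sup_{\xi\in K}\|(I_Y-Q_N)F'(\xi)\|_{W\to Y}.$$ Then: (i) If $W$ is finite-dimensional, then $\lim_{N\to+\infty}s_N=0$. (ii) If $s_N\le\frac{1}{2C}$, then for every $x_1,x_2\in A$ $$\|x_1-x_2\|_X\le 2C\,\|Q_N(F(x_1))-Q_N(F(x_2))\|_Y+3\,CDL\,\bigl(d(x_1,K)+d(x_2,K)\bigr),$$ where $L\ge 1$ is the Lipschitz constant of $F$.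
   Context: $F\in C^1(A,Y)$ means that $F$ is Fréchet differentiable at every $x\in A$, with derivative $F'(x)$ a continuous linear operator from $X$ to $Y$, and that $x\mapsto F'(x)$ is continuous in operator norm. $I_Y$ and $I_{\tilde Y}$ denote identity maps. $W$ carries the norm of $X$, and $\|T\|_{W\to Y}$ is the operator norm of the restriction $T|_W\colon W\to Y$. $d(x,K)=\inf_{z\in K}\|x-z\|_X$. $L\ge 1$ is a constant such that $\|F(x_1)-F(x_2)\|_Y\le L\|x_1-x_2\|_X$ for all $x_1,x_2\in A$. *)

theory Defs
  imports "HOL-Analysis.Analysis"
begin

text \<open>
  Operator norm of the restriction of \<open>T\<close> to the subspace \<open>W\<close>, which carries the norm of the
  ambient space; \<open>onorm\<close> from the library is the case \<open>W = UNIV\<close>. At \<open>w = 0\<close> the quotient is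
  \<open>0\<close>, so the trivial subspace gives norm \<open>0\<close>. Since \<open>T\<close> is bounded, for nonempty \<open>W\<close>
  this is the supremum of a nonempty bounded set of reals.
\<close>

definition onorm_on ::
  "'a::real_normed_vector set \<Rightarrow> ('a \<Rightarrow>\<^sub>L 'b::real_normed_vector) \<Rightarrow> real" where
  "onorm_on W T = (SUP w\<in>W. norm (blinfun_apply T w) / norm w)"

definition finite_dim_subspace :: "'a::real_vector set \<Rightarrow> bool" where
  "finite_dim_subspace W \<longleftrightarrow> subspace W \<and> (\<exists>B. finite B \<and> span B = W)"

text \<open>
  The supremum over \<open>\<xi> \<in> K\<close> of the operator norm of \<open>(I - Q) F'(\<xi>)\<close> restricted to \<open>W\<close>.
  For \<open>K\<close> nonempty and compact and \<open>F'\<close> continuous on \<open>K\<close> it is the supremum of a nonempty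
  bounded set of reals; otherwise it may be a junk value.
\<close>

definition sup_defect ::
  "'a::real_normed_vector set \<Rightarrow> 'a set \<Rightarrow> ('a \<Rightarrow> 'a \<Rightarrow>\<^sub>L 'b::real_normed_vector) \<Rightarrow> ('b \<Rightarrow>\<^sub>L 'b) \<Rightarrow> real"
where
  "sup_defect W K F' Q = (SUP \<xi>\<in>K. onorm_on W ((id_blinfun - Q) o\<^sub>L F' \<xi>))"

end

theory Submission
  imports Defs
begin

text \<open>
  For (ii), replace \<open>x1\<close> and \<open>x2\<close> by nearest points \<open>z1\<close> and \<open>z2\<close> of the compact set \<open>K\<close>. Since
  \<open>K\<close> is convex and lies in \<open>W\<close>, the segment between them stays in \<open>K\<close> and its direction lies in
  \<open>W\<close>, so the mean value inequality for \<open>(I - Q) \<circ> F\<close> only sees the restrictions of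
  \<open>(I - Q) F'(\<xi>)\<close> to \<open>W\<close>, and \<open>(I - Q) \<circ> F\<close> is Lipschitz on \<open>K\<close> with constant
  \<open>s = sup_defect W K F' Q\<close> (\<open>defect_mean_value\<close>). If \<open>C * s \<le> 1/2\<close>, the part of the stability
  estimate that \<open>Q\<close> loses is at most half of the left-hand side, so it is absorbed there and
  \<open>F\<close> may be replaced by \<open>Q \<circ> F\<close> at the price of doubling \<open>C\<close> (\<open>stability_after_projection\<close>).
  Moving from \<open>z1\<close>, \<open>z2\<close> back to \<open>x1\<close>, \<open>x2\<close> costs \<open>1 + 2 * C * D * L \<le> 3 * C * D * L\<close> times the
  distances to \<open>K\<close>.

  For (i), the vectors \<open>F'(\<xi>) w\<close> with \<open>\<xi> \<in> K\<close> and \<open>w\<close> in the unit ball of \<open>W\<close> form a continuous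
  image of a product of two compact sets: this is where the finite dimension of \<open>W\<close> enters
  (\<open>compact_span_Int_cball\<close>). On a compact set, pointwise convergence \<open>Q\<^sub>N y \<rightarrow> y\<close> of operators of
  bounded norm is uniform (\<open>pointwise_null_imp_uniformly_null_on_compact\<close>), and the uniform bound
  is exactly a bound for \<open>s\<^sub>N\<close>.
\<close>

section \<open>Uniform convergence of bounded operators on compact sets\<close>

text \<open>
  Operators of norm at most \<open>M\<close> are equicontinuous, so smallness on a finite \<open>e / (2 * M)\<close>-net,
  which is a finite conjunction of eventual statements, spreads to the whole set.
\<close>

lemma pointwise_null_imp_uniformly_null_on_compact:
  fixes R :: "'i \<Rightarrow> 'a::real_normed_vector \<Rightarrow>\<^sub>L 'b::real_normed_vector"
  assumes "compact Z" "M > 0" "\<And>i. norm (R i) \<le> M"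
    and null: "\<And>z. z \<in> Z \<Longrightarrow> ((\<lambda>i. R i z) \<longlongrightarrow> 0) \<F>" and "e > 0"
  shows "\<forall>\<^sub>F i in \<F>. \<forall>z\<in>Z. norm (R i z) \<le> e"
proof -
  define d where "d = e / (2 * M)"
  have "d > 0" using assms by (simp add: d_def)
  then have "Z \<subseteq> (\<Union>x\<in>Z. ball x d)" by auto
  then obtain T where T: "finite T" "T \<subseteq> Z" "Z \<subseteq> (\<Union>x\<in>T. ball x d)"
    by (rule compactE_image[OF \<open>compact Z\<close>, rotated]) auto
  have "\<forall>\<^sub>F i in \<F>. \<forall>t\<in>T. norm (R i t) < e / 2"
  proof (rule eventually_ball_finite[OF \<open>finite T\<close>], rule ballI)
    fix t assume "t \<in> T"
    then have "((\<lambda>i. R i t) \<longlongrightarrow> 0) \<F>" using null T by blast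
    from tendstoD[OF this, of "e / 2"] show "\<forall>\<^sub>F i in \<F>. norm (R i t) < e / 2"
      using \<open>e > 0\<close> by simp
  qed
  then show ?thesis
  proof (rule eventually_mono, intro ballI)
    fix i z assume small: "\<forall>t\<in>T. norm (R i t) < e / 2" and "z \<in> Z"
    then obtain t where t: "t \<in> T" "norm (z - t) \<le> d"
      using T by (fastforce simp: dist_norm norm_minus_commute)
    have "norm (R i (z - t)) \<le> norm (R i) * norm (z - t)" by (rule norm_blinfun)
    also have "\<dots> \<le> M * d"
      using assms t \<open>d > 0\<close> by (intro mult_mono) auto
    also have "\<dots> = e / 2" using \<open>M > 0\<close> by (simp add: d_def)
    finally have "norm (R i (z - t)) \<le> e / 2" .
    moreover have "R i z = R i (z - t) + R i t" by (simp add: blinfun.diff_right)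
    ultimately show "norm (R i z) \<le> e"
      using norm_triangle_ineq[of "R i (z - t)" "R i t"] small t by fastforce
  qed
qed

section \<open>Closed balls of finite-dimensional subspaces are compact\<close>

lemma closed_if_compact_Int_cball:
  fixes S :: "'a::real_normed_vector set"
  assumes "\<And>r. compact (S \<inter> cball 0 r)"
  shows "closed S"
  unfolding closed_sequential_limits
proof (intro allI impI, elim conjE)
  fix x l assume x: "\<forall>n. x n \<in> S" and lim: "x \<longlonglongrightarrow> l"
  obtain r where "\<And>n. norm (x n) \<le> r"
    using convergent_imp_Bseq[OF convergentI[OF lim]] by (auto simp: Bseq_def)
  then have "\<forall>n. x n \<in> S \<inter> cball 0 r" using x by simp
  then have "l \<in> S \<inter> cball 0 r"
    using compact_imp_closed[OF assms] lim unfolding closed_sequential_limits by blast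
  then show "l \<in> S" by simp
qed

text \<open>
  Induction on the spanning set. The span already treated is closed, so a new vector \<open>b\<close> has
  positive distance \<open>d\<close> from it. This bounds the coefficient of \<open>b\<close> in a vector of norm at most
  \<open>r\<close> by \<open>r / d\<close>, hence also the remaining component, and the new ball lies in the continuous
  image of a compact product.
\<close>

lemma compact_span_Int_cball:
  fixes B :: "'a::real_normed_vector set"
  assumes "finite B"
  shows "compact (span B \<inter> cball 0 r)"
  using assms
proof (induction B arbitrary: r rule: finite_induct)
  case empty
  then show ?case by (auto intro: finite_imp_compact)
next
  case (insert b B)
  show ?case
  proof (cases "b \<in> span B")
    case True
    then show ?thesis using insert.IH by (simp add: span_redundant)
  next
    case False
    define d where "d = infdist b (span B)"
    have "closed (span B)" by (rule closed_if_compact_Int_cball[OF insert.IH])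
    then have "d \<noteq> 0"
      using False in_closed_iff_infdist_zero[of "span B" b] span_zero unfolding d_def by blast
    then have "d > 0" using infdist_nonneg[of b "span B"] by (simp add: d_def)
    define R where "R = r + r / d * norm b"
    define I where "I = (\<lambda>(a, v). a *\<^sub>R b + v) ` ({- (r / d)..r / d} \<times> (span B \<inter> cball 0 R))"
    have "compact I"
      unfolding I_def case_prod_unfold
      by (intro compact_continuous_image continuous_intros compact_Times insert.IH compact_Icc)
    have "I \<subseteq> span (insert b B)"
      unfolding I_def
      by (auto intro!: span_add span_scale intro: span_base span_mono[THEN subsetD, of B])
    moreover have "span (insert b B) \<inter> cball 0 r \<subseteq> I"
    proof
      fix w assume w: "w \<in> span (insert b B) \<inter> cball 0 r"
      then obtain a where v: "w - a *\<^sub>R b \<in> span B"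
        using span_breakdown_eq[of w b B] by blast
      have nw: "norm w \<le> r" using w by simp
      have ad: "\<bar>a\<bar> * d \<le> norm w"
      proof (cases "a = 0")
        case False
        have "- (1 / a) *\<^sub>R (w - a *\<^sub>R b) \<in> span B" using v by (rule span_scale)
        then have "d \<le> dist b (- (1 / a) *\<^sub>R (w - a *\<^sub>R b))"
          unfolding d_def by (rule infdist_le)
        also have "\<dots> = norm w / \<bar>a\<bar>"
          using False by (simp add: dist_norm algebra_simps)
        finally show ?thesis using False by (simp add: field_simps)
      qed simp
      then have a: "\<bar>a\<bar> \<le> r / d" using nw \<open>d > 0\<close> by (simp add: field_simps)
      have "norm (w - a *\<^sub>R b) \<le> norm w + \<bar>a\<bar> * norm b"
        using norm_triangle_ineq4[of w "a *\<^sub>R b"] by simp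
      also have "\<dots> \<le> R"
        unfolding R_def using nw a by (intro add_mono mult_right_mono) auto
      finally have "(a, w - a *\<^sub>R b) \<in> {- (r / d)..r / d} \<times> (span B \<inter> cball 0 R)"
        using v a by auto
      then show "w \<in> I" unfolding I_def by (intro image_eqI) auto
    qed
    ultimately have "span (insert b B) \<inter> cball 0 r = I \<inter> cball 0 r" by blast
    then show ?thesis using \<open>compact I\<close> by (simp add: compact_Int_closed)
  qed
qed

section \<open>Restricted operator norms and the defect\<close>

lemma norm_ratio_le_norm_blinfun:
  "norm (blinfun_apply T w) / norm w \<le> norm T"
  using norm_blinfun[of T w] by (cases "w = 0") (auto simp: divide_le_eq)

lemma bdd_above_norm_ratios: "bdd_above ((\<lambda>w. norm (blinfun_apply T w) / norm w) ` W)"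
  using norm_ratio_le_norm_blinfun[of T] by (intro bdd_aboveI2)

lemma norm_le_onorm_on:
  assumes "w \<in> W"
  shows "norm (blinfun_apply T w) \<le> onorm_on W T * norm w"
proof (cases "w = 0")
  case False
  have "norm (blinfun_apply T w) / norm w \<le> onorm_on W T"
    unfolding onorm_on_def using assms by (intro cSUP_upper bdd_above_norm_ratios)
  then show ?thesis using False by (simp add: divide_le_eq)
qed simp

lemma onorm_on_nonneg:
  assumes "0 \<in> W"
  shows "0 \<le> onorm_on W T"
  using cSUP_upper[OF assms bdd_above_norm_ratios[of T W]] by (simp add: onorm_on_def)

lemma onorm_on_le_norm:
  assumes "W \<noteq> {}"
  shows "onorm_on W T \<le> norm T"
  unfolding onorm_on_def using assms by (intro cSUP_least norm_ratio_le_norm_blinfun)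

lemma onorm_on_subspace_le:
  assumes "subspace W" "0 \<le> e"
    and unit: "\<And>w. w \<in> W \<Longrightarrow> norm w \<le> 1 \<Longrightarrow> norm (blinfun_apply T w) \<le> e"
  shows "onorm_on W T \<le> e"
  unfolding onorm_on_def
proof (rule cSUP_least)
  show "W \<noteq> {}" using subspace_0[OF assms(1)] by blast
  fix w assume "w \<in> W"
  then have "norm (blinfun_apply T ((1 / norm w) *\<^sub>R w)) \<le> e"
    using assms(1) by (intro unit subspace_scale) auto
  then show "norm (blinfun_apply T w) / norm w \<le> e"
    by (simp add: blinfun.scaleR_right)
qed

text \<open>
  Compactness of \<open>K\<close> bounds the operators, so that the supremum in \<open>sup_defect\<close> is a genuine
  upper bound for each of its terms.
\<close>

lemma onorm_on_le_sup_defect: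
  assumes "compact K" "continuous_on K F'" "W \<noteq> {}" "\<xi> \<in> K"
  shows "onorm_on W ((id_blinfun - Q) o\<^sub>L F' \<xi>) \<le> sup_defect W K F' Q"
proof -
  have "compact ((\<lambda>\<xi>. (id_blinfun - Q) o\<^sub>L F' \<xi>) ` K)"
    using assms by (intro compact_continuous_image continuous_intros)
  then obtain b where b: "\<forall>T\<in>(\<lambda>\<xi>. (id_blinfun - Q) o\<^sub>L F' \<xi>) ` K. norm T \<le> b"
    using compact_imp_bounded[THEN bounded_iff[THEN iffD1]] by meson
  then have "bdd_above ((\<lambda>\<xi>. onorm_on W ((id_blinfun - Q) o\<^sub>L F' \<xi>)) ` K)"
    using onorm_on_le_norm[OF \<open>W \<noteq> {}\<close>] b
    by (intro bdd_aboveI2[where M = b]) (blast intro: order_trans)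
  then show ?thesis
    unfolding sup_defect_def using \<open>\<xi> \<in> K\<close> by (intro cSUP_upper)
qed

section \<open>Vanishing of the defect for finite-dimensional subspaces\<close>

lemma sup_defect_tendsto_0:
  fixes F' :: "'x::real_normed_vector \<Rightarrow> 'x \<Rightarrow>\<^sub>L 'y::real_normed_vector"
    and Q :: "nat \<Rightarrow> 'y \<Rightarrow>\<^sub>L 'y"
  assumes W: "finite_dim_subspace W" and K: "compact K" "K \<noteq> {}"
    and cont: "continuous_on K F'"
    and ran: "\<And>\<xi>. \<xi> \<in> K \<Longrightarrow> blinfun_apply (F' \<xi>) ` W \<subseteq> Y'"
    and QD: "\<And>N. norm (Q N) \<le> D"
    and lim: "\<And>y. y \<in> Y' \<Longrightarrow> (\<lambda>N. norm (blinfun_apply (Q N) y - y)) \<longlonglongrightarrow> 0"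
  shows "(\<lambda>N. sup_defect W K F' (Q N)) \<longlonglongrightarrow> 0"
proof (rule tendstoI)
  fix e :: real assume "e > 0"
  have sub: "subspace W" using W by (simp add: finite_dim_subspace_def)
  have "0 \<in> W" using sub by (rule subspace_0)
  have "compact (W \<inter> cball 0 1)"
    using W compact_span_Int_cball by (auto simp: finite_dim_subspace_def)
  then have "compact (K \<times> (W \<inter> cball 0 1))" using K by (intro compact_Times)
  moreover have "continuous_on (K \<times> (W \<inter> cball 0 1)) (\<lambda>p. F' (fst p) (snd p))"
    by (intro continuous_intros continuous_on_compose2[OF cont]) auto
  ultimately have Z: "compact ((\<lambda>p. F' (fst p) (snd p)) ` (K \<times> (W \<inter> cball 0 1)))" (is "compact ?Z")
    by (rule compact_continuous_image[rotated])
  have "\<forall>\<^sub>F N in sequentially. \<forall>z\<in>?Z. norm ((id_blinfun - Q N) z) \<le> e / 2"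
  proof (rule pointwise_null_imp_uniformly_null_on_compact[OF Z, where M = "1 + D"])
    show "0 < 1 + D" using norm_ge_zero[of "Q 0"] QD[of 0] by linarith
    show "norm (id_blinfun - Q N) \<le> 1 + D" for N
      using norm_triangle_ineq4[of id_blinfun "Q N"] norm_blinfun_id_le QD[of N]
      by (meson add_mono order_trans)
    fix z assume "z \<in> ?Z"
    then have "z \<in> Y'" using ran by fastforce
    then show "(\<lambda>N. (id_blinfun - Q N) z) \<longlonglongrightarrow> 0"
      using lim[of z]
      by (subst tendsto_norm_zero_iff[symmetric])
        (simp add: blinfun.diff_left norm_minus_commute)
  qed (use \<open>e > 0\<close> in simp)
  then show "\<forall>\<^sub>F N in sequentially. dist (sup_defect W K F' (Q N)) 0 < e"
  proof (rule eventually_mono)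
    fix N assume small: "\<forall>z\<in>?Z. norm ((id_blinfun - Q N) z) \<le> e / 2"
    have "sup_defect W K F' (Q N) \<le> e / 2"
      unfolding sup_defect_def
    proof (rule cSUP_least[OF \<open>K \<noteq> {}\<close>], rule onorm_on_subspace_le[OF sub])
      fix \<xi> w assume "\<xi> \<in> K" "w \<in> W" "norm w \<le> 1"
      then have "F' \<xi> w \<in> ?Z" by (intro image_eqI[of _ _ "(\<xi>, w)"]) auto
      then show "norm (((id_blinfun - Q N) o\<^sub>L F' \<xi>) w) \<le> e / 2"
        using bspec[OF small] by simp
    qed (use \<open>e > 0\<close> in simp)
    moreover obtain \<xi> where "\<xi> \<in> K" using \<open>K \<noteq> {}\<close> by blast
    then have "0 \<le> sup_defect W K F' (Q N)"
      using onorm_on_nonneg[OF \<open>0 \<in> W\<close>] onorm_on_le_sup_defect[OF K(1) cont] \<open>0 \<in> W\<close>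
      by (metis empty_iff order_trans)
    ultimately show "dist (sup_defect W K F' (Q N)) 0 < e" using \<open>e > 0\<close> by simp
  qed
qed

section \<open>Stability after applying the operators\<close>

text \<open>
  The usual mean value inequality would involve the full norm of \<open>(I - Q) F'(\<xi>)\<close>. Along a
  segment in \<open>K\<close> the derivative is only evaluated at \<open>z2 - z1 \<in> W\<close>, so the norm of its
  restriction to \<open>W\<close> is enough; hence the reduction to a curve of one real variable.
\<close>

lemma defect_mean_value:
  fixes F :: "'x::real_normed_vector \<Rightarrow> 'y::real_normed_vector"
  assumes "subspace W" "K \<subseteq> W" "compact K" "convex K"
    and der: "\<And>x. x \<in> K \<Longrightarrow> (F has_derivative blinfun_apply (F' x)) (at x)"
    and cont: "continuous_on K F'"
    and z: "z1 \<in> K" "z2 \<in> K"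
  shows "norm ((id_blinfun - Q) (F z1 - F z2)) \<le> sup_defect W K F' Q * norm (z1 - z2)"
proof -
  let ?R = "id_blinfun - Q" and ?s = "sup_defect W K F' Q"
  define p where "p t = z1 + t *\<^sub>R (z2 - z1)" for t :: real
  have pK: "p t \<in> K" if "t \<in> {0..1}" for t
    using convexD_alt[OF \<open>convex K\<close> z, of t] that by (simp add: p_def algebra_simps)
  have dW: "z2 - z1 \<in> W" using assms z by (blast intro: subspace_diff)
  have "norm (?R (F (p 1)) - ?R (F (p 0))) \<le> ?s * norm (z2 - z1) * norm (1 - 0 :: real)"
  proof (rule differentiable_bound[where S = "{0..1}"
        and f' = "\<lambda>t h. h *\<^sub>R ?R (F' (p t) (z2 - z1))"])
    fix t :: real assume t: "t \<in> {0..1}"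
    have "(p has_derivative (\<lambda>h. h *\<^sub>R (z2 - z1))) (at t within {0..1})"
      unfolding p_def by (auto intro!: derivative_eq_intros)
    from has_derivative_compose[OF this der[OF pK[OF t]]]
    have "((\<lambda>t. F (p t)) has_derivative (\<lambda>h. F' (p t) (h *\<^sub>R (z2 - z1)))) (at t within {0..1})" .
    from bounded_linear.has_derivative[OF blinfun.bounded_linear_right[of ?R] this]
    show "((\<lambda>t. ?R (F (p t))) has_derivative (\<lambda>h. h *\<^sub>R ?R (F' (p t) (z2 - z1))))
        (at t within {0..1})"
      by (simp add: blinfun.scaleR_right)
    have "norm (?R (F' (p t) (z2 - z1))) \<le> onorm_on W (?R o\<^sub>L F' (p t)) * norm (z2 - z1)"
      using norm_le_onorm_on[OF dW, of "?R o\<^sub>L F' (p t)"] by simp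
    also have "\<dots> \<le> ?s * norm (z2 - z1)"
      using dW pK[OF t] by (intro mult_right_mono onorm_on_le_sup_defect[OF \<open>compact K\<close> cont]) auto
    finally show "onorm (\<lambda>h. h *\<^sub>R ?R (F' (p t) (z2 - z1))) \<le> ?s * norm (z2 - z1)"
      by (intro onorm_le) (simp add: mult.commute mult_left_mono)
  qed auto
  then show ?thesis
    by (simp add: p_def blinfun.diff_right norm_minus_commute)
qed

lemma stability_after_projection:
  fixes F :: "'x::real_normed_vector \<Rightarrow> 'y::real_normed_vector"
  assumes "C > 0"
    and stable: "norm (z1 - z2) \<le> C * norm (F z1 - F z2)"
    and defect: "norm ((id_blinfun - Q) (F z1 - F z2)) \<le> s * norm (z1 - z2)"
    and s: "s \<le> 1 / (2 * C)"
  shows "norm (z1 - z2) \<le> 2 * C * norm (blinfun_apply Q (F z1) - blinfun_apply Q (F z2))"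
proof -
  have "F z1 - F z2 = (Q (F z1) - Q (F z2)) + (id_blinfun - Q) (F z1 - F z2)"
    by (simp add: blinfun.diff_left blinfun.diff_right)
  then have "norm (F z1 - F z2)
      \<le> norm (Q (F z1) - Q (F z2)) + norm ((id_blinfun - Q) (F z1 - F z2))"
    by (metis norm_triangle_ineq)
  also have "\<dots> \<le> norm (Q (F z1) - Q (F z2)) + 1 / (2 * C) * norm (z1 - z2)"
    using defect mult_right_mono[OF s norm_ge_zero[of "z1 - z2"]] by linarith
  finally have "C * norm (F z1 - F z2)
      \<le> C * (norm (Q (F z1) - Q (F z2)) + 1 / (2 * C) * norm (z1 - z2))"
    using \<open>C > 0\<close> by (intro mult_left_mono) auto
  then show ?thesis using stable \<open>C > 0\<close> by (simp add: distrib_left)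
qed

lemma nearest_point_in_compact:
  fixes x :: "'a::metric_space"
  assumes "compact K" "K \<noteq> {}"
  obtains z where "z \<in> K" "infdist x K = dist x z"
proof -
  obtain z where z: "z \<in> K" "\<forall>y\<in>K. dist x z \<le> dist x y"
    using continuous_attains_inf[OF assms, of "dist x"]
      continuous_on_dist[OF continuous_on_const continuous_on_id] by meson
  then have "infdist x K = dist x z"
    unfolding infdist_notempty[OF \<open>K \<noteq> {}\<close>] by (intro cInf_eq_minimum) auto
  with z(1) show thesis by (rule that)
qed

text \<open>
  Nothing but the triangle inequality: \<open>Q \<circ> F\<close> is Lipschitz with constant \<open>D * L\<close>, so a stability
  estimate at \<open>z1\<close>, \<open>z2\<close> passes to nearby points.
\<close>

lemma stability_at_nearby_points:
  fixes F :: "'x::real_normed_vector \<Rightarrow> 'y::real_normed_vector"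
  assumes ge: "C \<ge> 1" "D \<ge> 1" "L \<ge> 1" and QD: "norm Q \<le> D"
    and lip: "L-lipschitz_on A F" and A: "x1 \<in> A" "x2 \<in> A" "z1 \<in> A" "z2 \<in> A"
    and stable: "norm (z1 - z2) \<le> 2 * C * norm (blinfun_apply Q (F z1) - blinfun_apply Q (F z2))"
  shows "norm (x1 - x2) \<le> 2 * C * norm (blinfun_apply Q (F x1) - blinfun_apply Q (F x2))
    + 3 * C * D * L * (dist x1 z1 + dist x2 z2)"
proof -
  define \<delta> where "\<delta> = dist x1 z1 + dist x2 z2"
  have move: "dist (Q (F x)) (Q (F z)) \<le> D * L * dist x z" if "x \<in> A" "z \<in> A" for x z
  proof -
    have "dist (Q (F x)) (Q (F z)) \<le> norm Q * dist (F x) (F z)"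
      using norm_blinfun[of Q "F x - F z"] by (simp add: dist_norm blinfun.diff_right)
    also have "\<dots> \<le> D * (L * dist x z)"
      using QD ge lipschitz_onD[OF lip that] by (intro mult_mono) auto
    finally show ?thesis by (simp add: mult.assoc)
  qed
  have "dist (Q (F z1)) (Q (F z2)) \<le>
      dist (Q (F x1)) (Q (F x2)) + (dist (Q (F x1)) (Q (F z1)) + dist (Q (F x2)) (Q (F z2)))"
    by metric
  also have "\<dots> \<le> dist (Q (F x1)) (Q (F x2)) + D * L * \<delta>"
    using move[OF A(1,3)] move[OF A(2,4)] by (simp add: \<delta>_def distrib_left)
  finally have "2 * C * dist (Q (F z1)) (Q (F z2))
      \<le> 2 * C * (dist (Q (F x1)) (Q (F x2)) + D * L * \<delta>)"
    using ge by (intro mult_left_mono) auto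
  moreover have "dist x1 x2 \<le> dist z1 z2 + \<delta>" unfolding \<delta>_def by metric
  moreover have "1 * \<delta> \<le> C * D * L * \<delta>"
  proof (rule mult_right_mono)
    show "1 \<le> C * D * L"
      using mult_mono[OF mult_mono[OF ge(1,2)] ge(3)] ge by simp
  qed (simp add: \<delta>_def)
  ultimately show ?thesis
    using stable unfolding \<delta>_def[symmetric] by (simp add: dist_norm algebra_simps)
qed

theorem theorem2:
  fixes A W K :: "'x::banach set"
    and F :: "'x \<Rightarrow> 'y::banach"
    and F' :: "'x \<Rightarrow> 'x \<Rightarrow>\<^sub>L 'y"
    and Q :: "nat \<Rightarrow> 'y \<Rightarrow>\<^sub>L 'y"
    and Y' :: "'y set"
    and C D L :: real
  assumes "open A"
    and "subspace W"
    and "K \<subseteq> W \<inter> A" and "K \<noteq> {}" and "compact K" and "convex K"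
    and "\<And>x. x \<in> A \<Longrightarrow> (F has_derivative blinfun_apply (F' x)) (at x)"
    and "continuous_on A F'"
    and "L \<ge> 1" and "L-lipschitz_on A F"
    and "C \<ge> 1"
    and "\<And>x1 x2. x1 \<in> K \<Longrightarrow> x2 \<in> K \<Longrightarrow> norm (x1 - x2) \<le> C * norm (F x1 - F x2)"
    and "subspace Y'" and "D \<ge> 1"
    and "\<And>\<xi>. \<xi> \<in> K \<Longrightarrow> blinfun_apply (F' \<xi>) ` W \<subseteq> Y'"
    and "\<And>N. norm (Q N) \<le> D"
    and "\<And>y. y \<in> Y' \<Longrightarrow> (\<lambda>N. norm (blinfun_apply (Q N) y - y)) \<longlonglongrightarrow> 0"
  shows "(finite_dim_subspace W \<longrightarrow> (\<lambda>N. sup_defect W K F' (Q N)) \<longlonglongrightarrow> 0) \<and>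
    (\<forall>N. sup_defect W K F' (Q N) \<le> 1 / (2 * C) \<longrightarrow>
      (\<forall>x1\<in>A. \<forall>x2\<in>A.
        norm (x1 - x2) \<le> 2 * C * norm (blinfun_apply (Q N) (F x1) - blinfun_apply (Q N) (F x2))
          + 3 * C * D * L * (infdist x1 K + infdist x2 K)))"
proof (intro conjI impI allI ballI)
  have KA: "K \<subseteq> A" and KW: "K \<subseteq> W" using \<open>K \<subseteq> W \<inter> A\<close> by auto
  have cont: "continuous_on K F'" using \<open>continuous_on A F'\<close> KA by (rule continuous_on_subset)
  show "(\<lambda>N. sup_defect W K F' (Q N)) \<longlonglongrightarrow> 0" if "finite_dim_subspace W"
    by (rule sup_defect_tendsto_0[OF that \<open>compact K\<close> \<open>K \<noteq> {}\<close> cont]) fact+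
  fix N x1 x2
  assume small: "sup_defect W K F' (Q N) \<le> 1 / (2 * C)" and x: "x1 \<in> A" "x2 \<in> A"
  obtain z1 where z1: "z1 \<in> K" "infdist x1 K = dist x1 z1"
    using nearest_point_in_compact[OF \<open>compact K\<close> \<open>K \<noteq> {}\<close>] by blast
  obtain z2 where z2: "z2 \<in> K" "infdist x2 K = dist x2 z2"
    using nearest_point_in_compact[OF \<open>compact K\<close> \<open>K \<noteq> {}\<close>] by blast
  have "norm ((id_blinfun - Q N) (F z1 - F z2)) \<le> sup_defect W K F' (Q N) * norm (z1 - z2)"
    using assms(7) KA z1 z2
    by (intro defect_mean_value[OF \<open>subspace W\<close> KW \<open>compact K\<close> \<open>convex K\<close> _ cont]) auto
  then have "norm (z1 - z2)
      \<le> 2 * C * norm (blinfun_apply (Q N) (F z1) - blinfun_apply (Q N) (F z2))"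
    using \<open>C \<ge> 1\<close> assms(12)[OF z1(1) z2(1)] small
    by (intro stability_after_projection[where s = "sup_defect W K F' (Q N)"]) auto
  then show "norm (x1 - x2)
      \<le> 2 * C * norm (blinfun_apply (Q N) (F x1) - blinfun_apply (Q N) (F x2))
        + 3 * C * D * L * (infdist x1 K + infdist x2 K)"
    unfolding z1(2) z2(2) using z1(1) z2(1) KA x
    by (intro stability_at_nearby_points[OF \<open>C \<ge> 1\<close> \<open>D \<ge> 1\<close> \<open>L \<ge> 1\<close> assms(16) \<open>L-lipschitz_on A F\<close>])
      auto
qed

end
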